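(* Let $\lambda>0$ and $$p_\lambda(x)=\frac{2\lambda^{1/4}}{\Gamma(1/4)}e^{-\lambda x^4},\qquad F(x)=\int_{-\infty}^xp_\lambda(t)\,dt,\qquad x\in\mathbb R .$$ For $z\in\mathbb R$ let $$f_z(x)=\begin{cases}\dfrac{F(x)(1-F(z))}{p_\lambda(x)},&x\le z,\\[2mm]\dfrac{F(z)(1-F(x))}{p_\lambda(x)},&x>z.\end{cases}$$ Then $$\sup_{z\in\mathbb R}\|f_z\|_\infty=\frac{\Gamma(1/4)}{8\lambda^{1/4}},\qquad \sup_{z\in\mathbb R}\|f_z'\|_\infty=1,\qquad \sup_{z\in\mathbb R}\,\sup_{x\in\mathbb R}|4\lambda x^3f_z(x)|=1 .$$
   Context: $\|\cdot\|_\infty$ denotes the supremum norm over $x\in\mathbb R$. The function $f_z$ is the bounded solution of the Stein equation $f_z'(x)-4\lambda x^3f_z(x)=\mathbf 1_{(-\infty,z]}(x)-F(z)$; its derivative $f_z'$ is understood on $\mathbb R\setminus\{z\}$ and $\|f_z'\|_\infty$ is the essential supremum of $|f_z'|$, equivalently its supremum over $\mathbb R\setminus\{z\}$. *)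

theory Defs
  imports "HOL-Analysis.Analysis"
begin

definition p_dens :: "real \<Rightarrow> real \<Rightarrow> real" where
  "p_dens lam x = 2 * lam powr (1/4) / Gamma (1/4) * exp (- lam * x ^ 4)"

definition F_cdf :: "real \<Rightarrow> real \<Rightarrow> real" where
  "F_cdf lam x = (LBINT t:{..x}. p_dens lam t)"

definition stein_sol :: "real \<Rightarrow> real \<Rightarrow> real \<Rightarrow> real" where
  "stein_sol lam z x =
     (if x \<le> z then F_cdf lam x * (1 - F_cdf lam z) / p_dens lam x
      else F_cdf lam z * (1 - F_cdf lam x) / p_dens lam x)"

text \<open>
  Suprema are taken in the extended reals, where the supremum of an unbounded set is \<open>\<infinity>\<close>; on type
  \<^typ>\<open>real\<close> the supremum of an unbounded set would be an unspecified number, so that an equation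
  between a supremum and a real number would not assert boundedness.
\<close>

definition sup_norm_on :: "real set \<Rightarrow> (real \<Rightarrow> real) \<Rightarrow> ereal" where
  "sup_norm_on S g = (SUP x\<in>S. ereal \<bar>g x\<bar>)"

end

theory Submission
  imports Defs "HOL-Real_Asymp.Real_Asymp"
begin

text \<open>
  The reflection \<open>F (-x) = 1 - F x\<close> gives \<open>f (-z) (-x) = f z x\<close>, so half of each estimate suffices, and
  \<open>f z x \<le> f x x = F x (1 - F x) / p x\<close> by monotonicity of \<open>F\<close>. The first supremum is attained at
  \<open>x = z = 0\<close>: for \<open>x \<ge> 0\<close> the derivative of \<open>F (1 - F) - p / (4 p 0)\<close> is \<open>p\<close> times a convex function
  vanishing at \<open>0\<close>, so it changes sign at most once, from negative to positive, while the function itself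
  vanishes at \<open>0\<close> and at infinity. The other two suprema rest on the Mills ratio bounds for
  \<open>4 lam x^3 (1 - F x) / p x\<close>, which lies below \<open>1\<close> for \<open>x \<ge> 0\<close> and tends to \<open>1\<close>; the value \<open>1\<close> is
  approached as \<open>x = z\<close>, respectively \<open>x\<close> just below \<open>z\<close>, tends to infinity.
\<close>

text \<open>A function that is nondecreasing on a right half-line stays below its limit at infinity.
  Both Mills bounds and the maximality of \<open>f 0 0\<close> come down to this.\<close>

lemma nonpos_if_deriv_nonneg_and_tendsto_0:
  fixes h h' :: "real \<Rightarrow> real"
  assumes der: "\<And>y. x \<le> y \<Longrightarrow> (h has_real_derivative h' y) (at y)"
    and nonneg: "\<And>y. x \<le> y \<Longrightarrow> 0 \<le> h' y"
    and lim: "(h \<longlongrightarrow> 0) at_top"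
  shows "h x \<le> 0"
proof (rule tendsto_lowerbound[OF lim])
  show "\<forall>\<^sub>F y in at_top. h x \<le> h y"
    using eventually_ge_at_top[of x]
  proof eventually_elim
    case (elim y)
    show ?case
      by (rule DERIV_nonneg_imp_nondecreasing[OF elim]) (use der nonneg in blast)
  qed
qed simp

locale quartic =
  fixes lam :: real
  assumes lam_pos: "lam > 0"
begin

abbreviation "p \<equiv> p_dens lam"
abbreviation "F \<equiv> F_cdf lam"
abbreviation "f \<equiv> stein_sol lam"

section \<open>The density and its total mass\<close>

lemma Gamma_pos: "Gamma (1/4 :: real) > 0"
  by (intro Gamma_real_pos) simp

lemma Gamma_neq_0 [simp]: "Gamma (1/4 :: real) \<noteq> 0"
  using Gamma_pos by linarith

lemma p_pos: "p x > 0"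
  unfolding p_dens_def using lam_pos Gamma_pos by (intro mult_pos_pos divide_pos_pos) auto

lemma p_minus [simp]: "p (-x) = p x"
  by (simp add: p_dens_def)

lemma DERIV_p [derivative_intros]:
  "(p has_real_derivative (-4 * lam * x ^ 3 * p x)) (at x)"
  unfolding p_dens_def by (auto intro!: derivative_eq_intros)

lemma continuous_on_p [continuous_intros]: "continuous_on A p"
  unfolding p_dens_def by (intro continuous_intros)

lemma measurable_p [measurable]: "p \<in> borel_measurable borel"
  unfolding p_dens_def by measurable

lemma p_at_top: "(p \<longlongrightarrow> 0) at_top"
proof -
  have "((\<lambda>x. exp (- lam * x ^ 4)) \<longlongrightarrow> 0) at_top"
    using lam_pos by real_asymp
  from tendsto_mult_right_zero[OF this] show ?thesis
    unfolding p_dens_def .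
qed

text \<open>Substitute \<open>t = lam * x ^ 4\<close> in Euler's integral for \<open>Gamma (1/4)\<close>.\<close>

lemma half_integral_p:
  "p absolutely_integrable_on {0<..} \<and> integral {0<..} p = 1/2"
proof -
  define \<gamma> :: "real \<Rightarrow> real" where "\<gamma> = (\<lambda>t. t powr (1/4 - 1) / exp t)"
  have "(\<gamma> has_integral Gamma (1/4)) {0..}"
    unfolding \<gamma>_def by (rule Gamma_integral_real) simp
  hence \<gamma>: "(\<gamma> has_integral Gamma (1/4)) {0<..}"
    \<comment> \<open>The null endpoint \<open>0\<close> is dropped because the pointwise identity
      of the integrands shown below fails there: its left side is \<open>0\<close> and its right
      side is positive.\<close>
    by (subst has_integral_spike_set_eq[of _ "{0..}"]) (auto intro: negligible_subset[of "{0}"])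
  have abs: "\<gamma> absolutely_integrable_on {0<..}"
    by (rule nonnegative_absolutely_integrable_1) (use \<gamma> in \<open>auto simp: \<gamma>_def\<close>)
  have img: "(\<lambda>x. lam * x ^ 4) ` {0<..} = {0<..}"
  proof (intro equalityI subsetI)
    fix y :: real assume "y \<in> {0<..}"
    then have "y = lam * (root 4 (y / lam)) ^ 4" "root 4 (y / lam) \<in> {0<..}"
      using lam_pos by auto
    then show "y \<in> (\<lambda>x. lam * x ^ 4) ` {0<..}" by blast
  qed (use lam_pos in auto)
  have inj: "inj_on (\<lambda>x. lam * x ^ 4) {0<..}"
    using lam_pos by (auto simp: inj_on_def power_eq_iff_eq_base)
  have der: "((\<lambda>x. lam * x ^ 4) has_field_derivative 4 * lam * x ^ 3) (at x within {0<..})" for x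
    by (rule derivative_eq_intros refl | simp)+
  \<comment> \<open>The Jacobian cancels the singularity of \<gamma>: \<open>x ^ 3\<close> against
    \<open>(x ^ 4) powr (1/4 - 1)\<close>. What is left of \<open>lam\<close> is
    \<open>lam powr (1/4)\<close>, the power in the normalising constant of
    \<open>p\<close>.\<close>
  have eq: "\<bar>4 * lam * x ^ 3\<bar> * \<gamma> (lam * x ^ 4) = (2 * Gamma (1/4)) * p x"
    if "x \<in> {0<..}" for x
  proof -
    have x: "x > 0" using that by simp
    have "(x ^ 4) powr (1/4 - 1) = (x powr 4) powr (1/4 - 1)"
      using x by simp
    also have "\<dots> = x powr (-3)"
      unfolding powr_powr by simp
    also have "\<dots> = 1 / x ^ 3"
      using x by (simp add: powr_minus_divide)
    finally have "(lam * x ^ 4) powr (1/4 - 1) = lam powr (1/4 - 1) * (1 / x ^ 3)"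
      using lam_pos x by (simp only: powr_mult zero_le_power less_imp_le)
    also have "lam powr (1/4 - 1) = lam powr (1/4) / lam"
      unfolding powr_diff using lam_pos by simp
    finally have powr: "(lam * x ^ 4) powr (1/4 - 1) = lam powr (1/4) / lam * (1 / x ^ 3)" .
    have "\<gamma> (lam * x ^ 4) = lam powr (1/4) / lam * (1 / x ^ 3) * exp (- lam * x ^ 4)"
      unfolding \<gamma>_def powr by (simp add: exp_minus inverse_eq_divide)
    moreover have "\<bar>4 * lam * x ^ 3\<bar> = 4 * lam * x ^ 3"
      using x lam_pos by simp
    ultimately have "\<bar>4 * lam * x ^ 3\<bar> * \<gamma> (lam * x ^ 4)
        = 4 * lam powr (1/4) * exp (- lam * x ^ 4)"
      using x lam_pos by simp
    also have "\<dots> = (2 * Gamma (1/4)) * p x"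
      unfolding p_dens_def by simp
    finally show ?thesis .
  qed
  have "(\<lambda>x. \<bar>4 * lam * x ^ 3\<bar> * \<gamma> (lam * x ^ 4)) absolutely_integrable_on {0<..} \<and>
      integral {0<..} (\<lambda>x. \<bar>4 * lam * x ^ 3\<bar> * \<gamma> (lam * x ^ 4)) = Gamma (1/4)"
    by (subst has_absolute_integral_change_of_variables_1'[OF _ der inj])
       (use abs \<gamma> in \<open>auto simp: img integral_unique\<close>)
  also have "(\<lambda>x. \<bar>4 * lam * x ^ 3\<bar> * \<gamma> (lam * x ^ 4)) absolutely_integrable_on {0<..} \<longleftrightarrow>
      (\<lambda>x. (2 * Gamma (1/4)) * p x) absolutely_integrable_on {0<..}"
    by (intro set_integrable_cong refl eq)
  also have "integral {0<..} (\<lambda>x. \<bar>4 * lam * x ^ 3\<bar> * \<gamma> (lam * x ^ 4)) =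
      integral {0<..} (\<lambda>x. (2 * Gamma (1/4)) * p x)"
    by (intro integral_cong eq)
  finally have "(\<lambda>x. (2 * Gamma (1/4)) * p x) absolutely_integrable_on {0<..}"
    "integral {0<..} (\<lambda>x. (2 * Gamma (1/4)) * p x) = Gamma (1/4)"
    by blast+
  thus ?thesis
    by (auto simp: field_simps)
qed

text \<open>The mass \<open>1/2\<close> of the half-line doubles because \<open>p\<close> is even.
  Most of the work moves the half-line integral from the gauge integral to
  \<open>lborel\<close>.\<close>

lemma has_bochner_integral_p: "has_bochner_integral lborel p 1"
proof -
  have *: "(\<lambda>x. indicator {0..} x *\<^sub>R p x) \<in> borel_measurable lborel" by measurable
  have "p absolutely_integrable_on {0..}"
    by (subst absolutely_integrable_spike_set_eq[of _ "{0<..}"])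
       (use half_integral_p in \<open>auto intro: negligible_subset[of "{0}"]\<close>)
  hence int: "set_integrable lborel {0..} p"
    unfolding set_integrable_def using integrable_completion[OF *] by blast
  have "(LBINT x:{0..}. p x) = integral {0<..} p"
    unfolding set_borel_integral_eq_integral(2)[OF int]
    by (rule integral_spike_set) (auto intro: negligible_subset[of "{0}"])
  hence "has_bochner_integral lborel (\<lambda>x. indicator {0..} x *\<^sub>R p x) (1/2)"
    using int half_integral_p
    by (simp add: has_bochner_integral_iff set_integrable_def set_lebesgue_integral_def)
  from has_bochner_integral_even_function[OF this p_minus] show ?thesis by simp
qed

section \<open>The distribution function: limit, reflection, derivative\<close>

lemma integrable_p: "set_integrable lborel S p" if "S \<in> sets borel"
  unfolding set_integrable_def
  by (rule integrable_mult_indicator)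
     (use that has_bochner_integral_p in \<open>simp_all add: has_bochner_integral_iff\<close>)

lemma F_eq_integral: "F x = integral {..x} p"
  unfolding F_cdf_def by (intro set_borel_integral_eq_integral(2) integrable_p) simp

lemma F_at_top: "(F \<longlongrightarrow> 1) at_top"
  unfolding F_cdf_def set_lebesgue_integral_def
    has_bochner_integral_integral_eq[OF has_bochner_integral_p, symmetric]
  by (rule tendsto_integral_at_top)
     (use has_bochner_integral_p in \<open>simp_all add: has_bochner_integral_iff\<close>)

text \<open>Reflecting the integration variable turns \<open>F (-x)\<close> into the upper tail at
  \<open>x\<close>. The two half-lines cover the line and overlap in one point, so their masses add
  up to \<open>1\<close>.\<close>

lemma F_minus: "F (-x) = 1 - F x"
proof -
  have "F (-x) = (LBINT t:{x..}. p t)"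
    unfolding F_cdf_def by (subst set_integral_reflect) (simp add: atLeast_def)
  also have "\<dots> = integral {x..} p"
    by (intro set_borel_integral_eq_integral(2) integrable_p) simp
  finally have "F x + F (-x) = integral {..x} p + integral {x..} p"
    by (simp add: F_eq_integral)
  also have "\<dots> = integral ({..x} \<union> {x..}) p"
    by (intro integral_Un[symmetric] set_borel_integral_eq_integral(1) integrable_p)
       (auto intro: negligible_subset[of "{x}"])
  also have "{..x} \<union> {x..} = UNIV" by auto
  also have "integral UNIV p = (LBINT t:UNIV. p t)"
    by (intro set_borel_integral_eq_integral(2)[symmetric] integrable_p) simp
  also have "\<dots> = 1"
    using has_bochner_integral_p by (simp add: set_lebesgue_integral_def has_bochner_integral_iff)
  finally show ?thesis by simp
qed

lemma DERIV_F [derivative_intros]: "(F has_real_derivative p x) (at x)"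
proof -
  \<comment> \<open>The fundamental theorem of calculus is applied on a compact interval with
    \<open>x\<close> in its interior; there \<open>F\<close> differs from the integral by the
    constant \<open>F ?a\<close>.\<close>
  let ?a = "x - 1" and ?b = "x + 1"
  have "((\<lambda>y. integral {?a..y} p) has_real_derivative p x) (at x within {?a..?b})"
    by (rule integral_has_real_derivative) (auto intro: continuous_intros)
  hence "((\<lambda>y. F ?a + integral {?a..y} p) has_real_derivative p x) (at x within {?a..?b})"
    by (auto intro!: derivative_eq_intros)
  moreover have "F ?a + integral {?a..y} p = F y" if "y \<in> {?a..?b}" for y
  proof -
    have "integral {..?a} p + integral {?a..y} p = integral ({..?a} \<union> {?a..y}) p"
      by (intro integral_Un[symmetric] set_borel_integral_eq_integral(1) integrable_p)
         (auto intro: negligible_subset[of "{?a}"])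
    also have "{..?a} \<union> {?a..y} = {..y}" using that by auto
    finally show ?thesis by (simp add: F_eq_integral)
  qed
  ultimately have "(F has_real_derivative p x) (at x within {?a..?b})"
    by (auto intro: has_field_derivative_transform_within[where d = 1])
  thus ?thesis by (simp add: at_within_Icc_at)
qed

lemma F_mono: "x \<le> y \<Longrightarrow> F x \<le> F y"
  by (rule DERIV_nonneg_imp_nondecreasing[of x y F]) (use DERIV_F less_imp_le[OF p_pos] in blast)+

lemma F_le_1: "F x \<le> 1"
  by (rule tendsto_lowerbound[OF F_at_top])
     (auto intro: eventually_mono[OF eventually_ge_at_top[of x]] F_mono)

lemma F_nonneg: "0 \<le> F x"
  using F_le_1[of "-x"] by (simp add: F_minus)

lemma F_0: "F 0 = 1/2"
  using F_minus[of 0] by simp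

section \<open>Mills ratio bounds\<close>

text \<open>The factor \<open>x ^ 3\<close> is frozen and only the argument of \<open>F\<close> and
  \<open>p\<close> varies. The derivative in \<open>y\<close> then has the sign of
  \<open>y ^ 3 - x ^ 3\<close>.\<close>

lemma Mills_upper:
  assumes "x \<ge> 0"
  shows "4 * lam * x ^ 3 * (1 - F x) \<le> p x"
proof -
  have "4 * lam * x ^ 3 * (1 - F x) - p x \<le> 0"
  proof (rule nonpos_if_deriv_nonneg_and_tendsto_0[where h = "\<lambda>y. 4 * lam * x ^ 3 * (1 - F y) - p y"])
    have "((\<lambda>y. 4 * lam * x ^ 3 * (1 - F y) - p y) \<longlongrightarrow> 4 * lam * x ^ 3 * (1 - 1) - 0) at_top"
      by (intro tendsto_intros F_at_top p_at_top)
    then show "((\<lambda>y. 4 * lam * x ^ 3 * (1 - F y) - p y) \<longlongrightarrow> 0) at_top" by simp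
  next
    fix y assume "x \<le> y"
    show "((\<lambda>y. 4 * lam * x ^ 3 * (1 - F y) - p y) has_real_derivative
           4 * lam * p y * (y ^ 3 - x ^ 3)) (at y)"
      by (auto intro!: derivative_eq_intros simp: algebra_simps)
    show "0 \<le> 4 * lam * p y * (y ^ 3 - x ^ 3)"
      using lam_pos p_pos[of y] \<open>x \<le> y\<close> assms by (simp add: power_mono)
  qed
  thus ?thesis by simp
qed

text \<open>The derivative of \<open>p y / (4 * lam * y ^ 3)\<close> is
  \<open>- p y * (1 + 3 / (4 * lam * y ^ 4))\<close>. The bracket decreases in \<open>y\<close>, so
  freezing it at \<open>x\<close> gives the constant \<open>k\<close> and a derivative of one
  sign.\<close>

lemma Mills_lower:
  assumes "x > 0"
  shows "p x / (1 + 3 / (4 * lam * x ^ 4)) \<le> 4 * lam * x ^ 3 * (1 - F x)"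
proof -
  define k where "k = 1 + 3 / (4 * lam * x ^ 4)"
  have k: "k > 0" unfolding k_def using lam_pos assms by (simp add: add_pos_pos)
  have "p x / (4 * lam * x ^ 3) - k * (1 - F x) \<le> 0"
  proof (rule nonpos_if_deriv_nonneg_and_tendsto_0[where h = "\<lambda>y. p y / (4 * lam * y ^ 3) - k * (1 - F y)"])
    have "((\<lambda>y. 1 / (4 * lam * y ^ 3)) \<longlongrightarrow> 0) at_top"
      using lam_pos by real_asymp
    from tendsto_mult[OF p_at_top this]
    have "((\<lambda>y. p y / (4 * lam * y ^ 3)) \<longlongrightarrow> 0) at_top" by simp
    then have "((\<lambda>y. p y / (4 * lam * y ^ 3) - k * (1 - F y)) \<longlongrightarrow> 0 - k * (1 - 1)) at_top"
      by (intro tendsto_intros F_at_top)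
    then show "((\<lambda>y. p y / (4 * lam * y ^ 3) - k * (1 - F y)) \<longlongrightarrow> 0) at_top" by simp
  next
    fix y assume "x \<le> y"
    then have y: "y > 0" using assms by simp
    show "((\<lambda>y. p y / (4 * lam * y ^ 3) - k * (1 - F y)) has_real_derivative
           p y * (k - (1 + 3 / (4 * lam * y ^ 4)))) (at y)"
      using y lam_pos
      by (auto intro!: derivative_eq_intros simp: field_simps power_numeral_reduce)
    have "3 / (4 * lam * y ^ 4) \<le> 3 / (4 * lam * x ^ 4)"
      using lam_pos assms y \<open>x \<le> y\<close> by (intro divide_left_mono mult_left_mono power_mono) auto
    then show "0 \<le> p y * (k - (1 + 3 / (4 * lam * y ^ 4)))"
      using p_pos[of y] unfolding k_def by simp
  qed
  hence "p x / (4 * lam * x ^ 3) \<le> k * (1 - F x)" by simp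
  hence "p x / k \<le> 4 * lam * x ^ 3 * (1 - F x)"
    using k lam_pos assms by (simp add: field_simps)
  thus ?thesis unfolding k_def .
qed

section \<open>The supremum of the Stein solution\<close>

lemma f_minus: "f (-z) (-x) = f z x"
  by (auto simp: stein_sol_def F_minus)

lemma f_nonneg: "0 \<le> f z x"
  using F_nonneg F_le_1 less_imp_le[OF p_pos] by (auto simp: stein_sol_def)

lemma f_le_diag: "f z x \<le> f x x"
proof -
  have "F x * (1 - F z) \<le> F x * (1 - F x)" if "x \<le> z"
    using F_mono[OF that] F_nonneg by (simp add: mult_left_mono)
  moreover have "F z * (1 - F x) \<le> F x * (1 - F x)" if "z \<le> x"
    using F_mono[OF that] F_le_1[of x] by (simp add: mult_right_mono)
  ultimately show ?thesis
    using less_imp_le[OF p_pos] by (simp add: stein_sol_def divide_right_mono)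
qed

text \<open>This is \<open>f x x \<le> f 0 0\<close> with denominators cleared; equality holds at
  \<open>0\<close>.\<close>

lemma F_mult_one_minus_F_le:
  assumes "x \<ge> 0"
  shows "F x * (1 - F x) \<le> p x / (4 * p 0)"
proof (rule ccontr)
  define h where "h = (\<lambda>y. F y * (1 - F y) - p y / (4 * p 0))"
  \<comment> \<open>The factor of \<open>p y\<close> in the derivative of \<open>h\<close>;
    \<open>k'\<close> is its derivative, and the monotonicity of \<open>k'\<close> is the convexity
    of \<open>k\<close>.\<close>
  define k where "k = (\<lambda>y. lam * y ^ 3 / p 0 - (2 * F y - 1))"
  define k' where "k' = (\<lambda>y. 3 * lam * y\<^sup>2 / p 0 - 2 * p y)"
  have p0: "p 0 > 0" by (rule p_pos)
  have h: "(h has_real_derivative p y * k y) (at y)" for y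
    unfolding h_def k_def using p0
    by (auto intro!: derivative_eq_intros simp: field_simps)
  have k: "(k has_real_derivative k' y) (at y)" for y
    unfolding k_def k'_def using p0
    by (auto intro!: derivative_eq_intros simp: field_simps)
  have k'_mono: "k' y \<le> k' w" if "0 \<le> y" "y \<le> w" for y w
  proof -
    have "p w \<le> p y" using that lam_pos Gamma_pos
      unfolding p_dens_def by (intro mult_left_mono) (auto intro: power_mono)
    moreover have "3 * lam * y\<^sup>2 / p 0 \<le> 3 * lam * w\<^sup>2 / p 0"
      using that lam_pos p0 by (intro divide_right_mono mult_left_mono power_mono) auto
    ultimately show ?thesis unfolding k'_def by simp
  qed
  assume "\<not> F x * (1 - F x) \<le> p x / (4 * p 0)"
  hence hx: "h x > 0" by (simp add: h_def)
  have h0: "h 0 = 0" using p0 by (simp add: h_def F_0)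
  have "x > 0" using hx h0 assms by (cases "x = 0") auto
  \<comment> \<open>A positive \<open>h x\<close> forces \<open>k\<close> to be positive at some
    \<xi> before \<open>x\<close>, and then \<open>k'\<close> to be positive at some \<eta> before
    \<xi>. From there on \<open>k'\<close> stays positive, so \<open>h\<close> can no longer
    decrease beyond \<open>x\<close>, contradicting its limit \<open>0\<close>.\<close>
  from MVT2[OF this h] obtain \<xi> where \<xi>: "0 < \<xi>" "\<xi> < x" "h x - h 0 = x * (p \<xi> * k \<xi>)"
    by auto
  have k\<xi>: "k \<xi> > 0"
    using \<xi> hx h0 \<open>x > 0\<close> p_pos[of \<xi>] by (simp add: zero_less_mult_iff)
  have k0: "k 0 = 0" by (simp add: k_def F_0)
  from MVT2[OF \<xi>(1) k] obtain \<eta> where \<eta>: "0 < \<eta>" "\<eta> < \<xi>" "k \<xi> - k 0 = \<xi> * k' \<eta>"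
    by auto
  have k'\<eta>: "k' \<eta> > 0"
    using \<eta> k\<xi> k0 \<xi> by (simp add: zero_less_mult_iff)
  have k_pos: "k y \<ge> 0" if "\<xi> \<le> y" for y
  proof -
    have "k \<xi> \<le> k y"
    proof (rule DERIV_nonneg_imp_nondecreasing[OF that])
      fix w assume "\<xi> \<le> w"
      then have "k' w \<ge> 0" using k'_mono[of \<eta> w] \<eta> k'\<eta> by simp
      then show "\<exists>d. (k has_real_derivative d) (at w) \<and> 0 \<le> d" using k by blast
    qed
    then show ?thesis using k\<xi> by simp
  qed
  have "h x \<le> 0"
  proof (rule nonpos_if_deriv_nonneg_and_tendsto_0[OF h])
    fix y assume "x \<le> y"
    then show "0 \<le> p y * k y" using k_pos[of y] \<xi> p_pos[of y] by simp
  next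
    have "(h \<longlongrightarrow> 1 * (1 - 1) - 0 / (4 * p 0)) at_top"
      unfolding h_def by (intro tendsto_intros F_at_top p_at_top) (use p0 in simp)
    then show "(h \<longlongrightarrow> 0) at_top" by simp
  qed
  with hx show False by simp
qed

lemma f_0_0: "f 0 0 = Gamma (1/4) / (8 * lam powr (1/4))"
  by (simp add: stein_sol_def F_0 p_dens_def)

lemma f_le: "f z x \<le> Gamma (1/4) / (8 * lam powr (1/4))"
proof -
  \<comment> \<open>The diagonal value \<open>f x x\<close> is even in \<open>x\<close>, so the
    bound for nonnegative arguments is enough.\<close>
  have "F \<bar>x\<bar> * (1 - F \<bar>x\<bar>) / p \<bar>x\<bar> \<le> 1 / (4 * p 0)"
    using F_mult_one_minus_F_le[of "\<bar>x\<bar>"] p_pos[of "\<bar>x\<bar>"] p_pos[of 0] by (simp add: field_simps)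
  also have "F \<bar>x\<bar> * (1 - F \<bar>x\<bar>) / p \<bar>x\<bar> = f x x"
    by (cases "x \<ge> 0") (auto simp: stein_sol_def F_minus abs_if)
  also have "1 / (4 * p 0) = f 0 0"
    by (simp add: stein_sol_def F_0)
  finally show ?thesis using f_le_diag[of z x] by (simp add: f_0_0)
qed

lemma sup_f: "(SUP z. sup_norm_on UNIV (f z)) = ereal (Gamma (1/4) / (8 * lam powr (1/4)))"
proof (rule antisym)
  show "(SUP z. sup_norm_on UNIV (f z)) \<le> ereal (Gamma (1/4) / (8 * lam powr (1/4)))"
    unfolding sup_norm_on_def by (intro SUP_least) (use f_nonneg f_le in simp)
  have "ereal (f 0 0) \<le> (SUP z. sup_norm_on UNIV (f z))"
    unfolding sup_norm_on_def
    by (rule SUP_upper2[of 0], simp, rule SUP_upper2[of 0]) auto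
  then show "ereal (Gamma (1/4) / (8 * lam powr (1/4))) \<le> (SUP z. sup_norm_on UNIV (f z))"
    unfolding f_0_0 .
qed

section \<open>The cubic term of the Stein equation\<close>

text \<open>The cubic term on the diagonal \<open>z = x\<close>, where it is largest for given
  \<open>x \<ge> 0\<close>. It supplies the lower bound for both remaining suprema.\<close>

definition drift :: "real \<Rightarrow> real" where
  "drift x = 4 * lam * x ^ 3 * f x x"

lemma drift_eq: "drift x = F x * (4 * lam * x ^ 3 * (1 - F x) / p x)"
  unfolding drift_def stein_sol_def by (simp only: order_refl if_True times_divide_eq_right mult_ac)

lemma drift_le:
  assumes "x \<ge> 0"
  shows "drift x \<le> F x"
proof -
  have "4 * lam * x ^ 3 * (1 - F x) / p x \<le> 1"
    using Mills_upper[OF assms] p_pos[of x] by simp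
  from mult_left_mono[OF this F_nonneg] show ?thesis by (simp add: drift_eq)
qed

text \<open>By \<open>drift_eq\<close> this is \<open>F\<close> times a Mills ratio;
  \<open>Mills_lower\<close> and \<open>drift_le\<close> squeeze it between two functions tending to
  \<open>1\<close>.\<close>

lemma drift_at_top: "(drift \<longlongrightarrow> 1) at_top"
proof (rule tendsto_sandwich[OF _ _ _ F_at_top])
  show "\<forall>\<^sub>F x in at_top. drift x \<le> F x"
    using eventually_ge_at_top[of 0] by eventually_elim (rule drift_le)
  show "\<forall>\<^sub>F x in at_top. F x * (1 / (1 + 3 / (4 * lam * x ^ 4))) \<le> drift x"
    using eventually_gt_at_top[of 0]
  proof eventually_elim
    case (elim x)
    have "1 / (1 + 3 / (4 * lam * x ^ 4)) = p x / (1 + 3 / (4 * lam * x ^ 4)) / p x"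
      using p_pos[of x] by simp
    also have "\<dots> \<le> 4 * lam * x ^ 3 * (1 - F x) / p x"
      by (rule divide_right_mono[OF Mills_lower[OF elim] less_imp_le[OF p_pos]])
    finally show ?case unfolding drift_eq by (rule mult_left_mono[OF _ F_nonneg])
  qed
  have "((\<lambda>x. 1 / (1 + 3 / (4 * lam * x ^ 4))) \<longlongrightarrow> 1) at_top"
    using lam_pos by real_asymp
  from tendsto_mult[OF F_at_top this]
  show "((\<lambda>x. F x * (1 / (1 + 3 / (4 * lam * x ^ 4)))) \<longlongrightarrow> 1) at_top" by simp
qed

lemma one_le_if_drift_le:
  assumes "\<And>x. ereal (drift x) \<le> S"
  shows "1 \<le> S"
proof -
  have "((\<lambda>x. ereal (drift x)) \<longlongrightarrow> ereal 1) at_top"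
    using drift_at_top by simp
  from tendsto_upperbound[OF this always_eventually, of S] show ?thesis
    using assms by (simp add: one_ereal_def)
qed

text \<open>The absolute value turns \<open>x ^ 3\<close> into \<open>\<bar>x\<bar> ^ 3\<close>.
  Since \<open>f x x\<close> is even, \<open>drift_le\<close> at \<open>\<bar>x\<bar>\<close> covers
  both signs of \<open>x\<close>.\<close>

lemma abs_drift_le: "\<bar>4 * lam * x ^ 3 * f z x\<bar> \<le> 1"
proof -
  have "4 * lam * \<bar>x\<bar> ^ 3 * f x x \<le> 1"
  proof -
    have "f x x = f \<bar>x\<bar> \<bar>x\<bar>" using f_minus[of x x] by (simp add: abs_if)
    then show ?thesis using drift_le[of "\<bar>x\<bar>"] F_le_1[of "\<bar>x\<bar>"] by (simp add: drift_def)
  qed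
  moreover have "4 * lam * \<bar>x\<bar> ^ 3 * f z x \<le> 4 * lam * \<bar>x\<bar> ^ 3 * f x x"
    using lam_pos f_le_diag by (intro mult_left_mono) auto
  ultimately have "4 * lam * \<bar>x\<bar> ^ 3 * f z x \<le> 1" by (rule order_trans[rotated])
  then show ?thesis
    using lam_pos f_nonneg[of z x] by (simp add: abs_mult power_abs)
qed

lemma sup_drift: "(SUP z. SUP x. ereal \<bar>4 * lam * x ^ 3 * f z x\<bar>) = 1"
proof (rule antisym)
  show "(SUP z. SUP x. ereal \<bar>4 * lam * x ^ 3 * f z x\<bar>) \<le> 1"
    by (intro SUP_least) (use abs_drift_le in simp)
  have "ereal (drift x) \<le> (SUP z. SUP x. ereal \<bar>4 * lam * x ^ 3 * f z x\<bar>)" for x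
    by (intro SUP_upper2[of x UNIV]) (auto simp: drift_def)
  from one_le_if_drift_le[OF this]
  show "1 \<le> (SUP z. SUP x. ereal \<bar>4 * lam * x ^ 3 * f z x\<bar>)" .
qed

section \<open>The derivative of the Stein solution\<close>

text \<open>The Stein equation on the side where the indicator equals \<open>1\<close>. The other
  side follows by reflection in \<open>deriv_f_minus\<close>.\<close>

lemma DERIV_f_left:
  assumes "x < z"
  shows "(f z has_real_derivative (1 - F z) + 4 * lam * x ^ 3 * f z x) (at x)"
proof (rule has_field_derivative_transform_within_open[where S = "{..<z}"])
  show "((\<lambda>x. F x * (1 - F z) / p x) has_real_derivative
         (1 - F z) + 4 * lam * x ^ 3 * f z x) (at x)"
    using p_pos[of x] assms
    by (auto intro!: derivative_eq_intros simp: stein_sol_def field_simps)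
qed (use assms in \<open>auto simp: stein_sol_def\<close>)

lemma deriv_f_left: "x < z \<Longrightarrow> deriv (f z) x = (1 - F z) + 4 * lam * x ^ 3 * f z x"
  by (rule DERIV_imp_deriv[OF DERIV_f_left])

lemma deriv_f_minus:
  assumes "z < x"
  shows "deriv (f z) x = - deriv (f (-z)) (-x)"
proof -
  have "((\<lambda>y. f (-z) (-y)) has_real_derivative - deriv (f (-z)) (-x)) (at x)"
    using DERIV_f_left[of "-x" "-z"] deriv_f_left[of "-x" "-z"] assms
    by (subst DERIV_mirror[symmetric]) simp
  then show ?thesis by (intro DERIV_imp_deriv) (simp add: f_minus)
qed

text \<open>For \<open>x \<ge> 0\<close> the cubic term is nonnegative and at most
  \<open>F x \<le> F z\<close>. For \<open>x < 0\<close> it is nonpositive, and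
  \<open>Mills_upper\<close> at \<open>-x\<close> keeps it above \<open>- (1 - F z)\<close>.\<close>

lemma deriv_f_left_bounds:
  assumes "x < z"
  shows "0 \<le> deriv (f z) x" "deriv (f z) x \<le> 1"
proof -
  have "0 \<le> deriv (f z) x \<and> deriv (f z) x \<le> 1"
  proof (cases "x \<ge> 0")
    case True
    have "4 * lam * x ^ 3 * f z x \<le> drift x"
      unfolding drift_def using lam_pos f_le_diag True by (intro mult_left_mono) auto
    then show ?thesis
      using drift_le[OF True] F_mono[of x z] F_le_1[of z] assms True lam_pos f_nonneg[of z x]
      by (auto simp: deriv_f_left)
  next
    case False
    then have "4 * lam * x ^ 3 \<le> 0"
      using lam_pos by (simp add: mult_le_0_iff power_le_zero_eq)
    then have "4 * lam * x ^ 3 * f z x \<le> 0"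
      using f_nonneg[of z x] by (simp add: mult_le_0_iff)
    moreover have "- (4 * lam * x ^ 3 * F x) \<le> p x"
      using Mills_upper[of "-x"] False by (simp add: F_minus)
    then have "- (4 * lam * x ^ 3 * F x / p x) \<le> 1"
      using p_pos[of x] by (simp add: field_simps)
    from mult_left_mono[OF this, of "1 - F z"] have "- (4 * lam * x ^ 3 * f z x) \<le> 1 - F z"
      using F_le_1[of z] assms by (simp add: stein_sol_def mult_ac)
    ultimately show ?thesis
      unfolding deriv_f_left[OF assms] using F_nonneg[of z] by (intro conjI; linarith)
  qed
  then show "0 \<le> deriv (f z) x" "deriv (f z) x \<le> 1" by auto
qed

lemma abs_deriv_f_le:
  assumes "x \<noteq> z"
  shows "\<bar>deriv (f z) x\<bar> \<le> 1"
proof (cases "x < z")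
  case True
  then show ?thesis using deriv_f_left_bounds[OF True] by simp
next
  case False
  then have "z < x" using assms by simp
  then show ?thesis
    unfolding deriv_f_minus[OF \<open>z < x\<close>] using deriv_f_left_bounds[of "-x" "-z"] by simp
qed

text \<open>The slope of \<open>f z\<close> jumps at \<open>z\<close>, and \<open>z\<close> is
  excluded from the supremum, so the left limit stands in for a value there.\<close>

lemma deriv_f_at_left: "((\<lambda>x. deriv (f z) x) \<longlongrightarrow> (1 - F z) + drift z) (at_left z)"
proof (rule Lim_transform_eventually)
  have "isCont F z" "isCont p z"
    by (auto intro: DERIV_isCont DERIV_F DERIV_p)
  then show "((\<lambda>x. (1 - F z) + 4 * lam * x ^ 3 * (F x * (1 - F z) / p x)) \<longlongrightarrow>
      (1 - F z) + drift z) (at_left z)"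
    unfolding drift_def stein_sol_def using p_pos[of z]
    by (auto intro!: tendsto_intros simp: isCont_def intro: tendsto_within_subset)
  show "\<forall>\<^sub>F x in at_left z. (1 - F z) + 4 * lam * x ^ 3 * (F x * (1 - F z) / p x) = deriv (f z) x"
    by (auto simp: eventually_at_left_field deriv_f_left stein_sol_def intro: lt_ex)
qed

lemma sup_deriv_f: "(SUP z. sup_norm_on (- {z}) (deriv (f z))) = 1" (is "?S = 1")
proof (rule antisym)
  show "?S \<le> 1"
    unfolding sup_norm_on_def by (intro SUP_least) (use abs_deriv_f_le in auto)
  \<comment> \<open>The supremum dominates the left limit \<open>(1 - F z) + drift z\<close> of the
    derivative, whose first summand is nonnegative.\<close>
  have "ereal (drift z) \<le> ?S" for z
  proof -
    have "ereal ((1 - F z) + drift z) \<le> ?S"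
    proof (rule tendsto_upperbound)
      show "((\<lambda>x. ereal (deriv (f z) x)) \<longlongrightarrow> ereal ((1 - F z) + drift z)) (at_left z)"
        using deriv_f_at_left by simp
      have "ereal (deriv (f z) x) \<le> ?S" if "x < z" for x
        unfolding sup_norm_on_def
        using that by (intro SUP_upper2[of z UNIV] SUP_upper2[of x "- {z}"]) auto
      then show "\<forall>\<^sub>F x in at_left z. ereal (deriv (f z) x) \<le> ?S"
        by (auto simp: eventually_at_left_field intro: lt_ex)
    qed simp
    moreover have "ereal (drift z) \<le> ereal ((1 - F z) + drift z)"
      using F_le_1[of z] by simp
    ultimately show ?thesis by (rule order_trans[rotated])
  qed
  from one_le_if_drift_le[OF this] show "1 \<le> ?S" .
qed

end

theorem corollary8p1:
  fixes lam :: real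
  assumes "lam > 0"
  shows "(SUP z. sup_norm_on UNIV (stein_sol lam z)) = ereal (Gamma (1/4) / (8 * lam powr (1/4))) \<and>
         (SUP z. sup_norm_on (- {z}) (deriv (stein_sol lam z))) = 1 \<and>
         (SUP z. SUP x. ereal \<bar>4 * lam * x ^ 3 * stein_sol lam z x\<bar>) = 1"
proof -
  interpret quartic lam by unfold_locales (rule assms)
  show ?thesis using sup_f sup_deriv_f sup_drift by blast
qed

end
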